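(* Assume the helper has a large buffer and the user has bursty data arrivals for offloading, partitioned with ratio $\theta$. Assume the helper's CPU is underutilized, i.e. $\sum_{k=1}^{K-1}\theta L_k<U_K$, and that the problem $$\min_{\boldsymbol{\ell}\ge\boldsymbol0}\ \sum_{k=1}^K\frac{\tau_k}{h^2}g\!\left(\frac{\ell_k}{\tau_k}\right)\quad\text{s.t.}\quad \sum_{k=1}^Kd_k(\ell_k)=\sum_{k=1}^K\ell_k=\sum_{k=1}^{K-1}\theta L_k,\qquad \sum_{j=1}^k\ell_j\le\sum_{j=1}^{k-1}\theta L_j,\ k=1,\dots,K,$$ is feasible. Then the energy-efficient transmission policy, i.e. the solution of this problem, is given by the shortest path in the effective offloading feasibility tunnel $$\bar{\mathcal T}_B(\theta)=\Big\{\boldsymbol{\ell}\ :\ [U_k-\bar\Delta(\theta)]^+\le\sum_{j=1}^k\ell_j\le\sum_{j=1}^{k-1}\theta L_j,\ k=1,\dots,K-1,\ \sum_{k=1}^K\ell_k=\sum_{k=1}^{K-1}\theta L_k\Big\},$$ where $\bar\Delta(\theta)=U_K-\sum_{k=1}^{K-1}\theta L_k$.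
   Context: A user with bursty data arrivals offloads data to a helper with a large buffer ($Q\ge\sum_{k=1}^K L_k$, so that there is no active buffer constraint). Events (the helper's CPU becoming idle, becoming busy, or new data arriving at the user) occur at times $0=\hat s_0<\hat s_1<\dots<\hat s_K$; epoch $k$ is $[\hat s_{k-1},\hat s_k]$ of length $\tau_k$, and $a_k\in\{0,1\}$ equals $1$ if the helper's CPU is idle in epoch $k$ and $0$ if busy; epoch $K$ is idle. $L_k\ge0$ is the amount of data arriving at the user at time $\hat s_k$ ($L_k=0$ if the event is not an arrival). With helper CPU frequency $f_h>0$ and $C>0$ cycles per bit, $U_k=\sum_{j=1}^ka_j\tau_jf_h/C$. Notation: $[x]^+=\max\{x,0\}$. Proportional data partitioning with ratio $\theta\in[0,1]$ assigns $\theta L_k$ bits of each arrival for offloading. A policy is $\boldsymbol{\ell}=(\ell_1,\dots,\ell_K)\ge\boldsymbol 0$, $\ell_k$ = bits offloaded in epoch $k$. The helper's computed bits and buffer contents evolve by $B_0=0$, $d_k(\ell_k)=\min\{B_{k-1}+\ell_k,\ a_k\tau_kf_h/C\}$, $B_k=\sum_{j=1}^k\ell_j-\sum_{j=1}^kd_j(\ell_j)$. The energy function is $g(x)=N_0(2^{x/W}-1)$, with constants $h,N_0,W>0$. The path of a policy is the piecewise-linear curve through the points $(\hat s_k,\sum_{j=1}^k\ell_j)$, $k=0,\dots,K$; its length is $\sum_{k=1}^K\sqrt{\ell_k^2+\tau_k^2}$. The shortest path in a tunnel is the path of minimum length among (nonnegative) policies in it. *)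

theory Defs
  imports Complex_Main "HOL-Library.FuncSet"
begin

text \<open>
  Epochs are numbered from 1 to K; the value of an epoch-indexed function at 0 is never used.
  A policy is a nonnegative function on the epochs 1, ..., K. It is taken to be extensional, so that
  policies correspond exactly to nonnegative vectors of length K.
\<close>

definition policies :: "nat \<Rightarrow> (nat \<Rightarrow> real) set" where
  "policies K = {1..K} \<rightarrow>\<^sub>E {0..}"

definition epoch_length :: "(nat \<Rightarrow> real) \<Rightarrow> nat \<Rightarrow> real" where
  "epoch_length s k = s k - s (k - 1)"

definition capacity ::
  "(nat \<Rightarrow> real) \<Rightarrow> (nat \<Rightarrow> real) \<Rightarrow> real \<Rightarrow> real \<Rightarrow> nat \<Rightarrow> real" where
  "capacity s a f\<^sub>h C k = a k * epoch_length s k * f\<^sub>h / C"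

definition cum_capacity ::
  "(nat \<Rightarrow> real) \<Rightarrow> (nat \<Rightarrow> real) \<Rightarrow> real \<Rightarrow> real \<Rightarrow> nat \<Rightarrow> real" where
  "cum_capacity s a f\<^sub>h C k = (\<Sum>j=1..k. capacity s a f\<^sub>h C j)"

text \<open>
  The bits d computed by the helper in each epoch and its buffer contents B at the end of each
  epoch, for per-epoch computing capacities c and a policy l. The value of d at 0 is a dummy.
\<close>

function (sequential)
  computed_bits :: "(nat \<Rightarrow> real) \<Rightarrow> (nat \<Rightarrow> real) \<Rightarrow> nat \<Rightarrow> real" and
  buffer_contents :: "(nat \<Rightarrow> real) \<Rightarrow> (nat \<Rightarrow> real) \<Rightarrow> nat \<Rightarrow> real"
where
  "computed_bits c l 0 = 0"
| "computed_bits c l (Suc k) = min (buffer_contents c l k + l (Suc k)) (c (Suc k))"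
| "buffer_contents c l k = (\<Sum>j=1..k. l j) - (\<Sum>j=1..k. computed_bits c l j)"
  by pat_completeness auto
termination
  by (relation "measure (case_sum (\<lambda>(c, l, k). 2 * k) (\<lambda>(c, l, k). 2 * k + 1))") auto

lemma buffer_contents_0: "buffer_contents c l 0 = 0"
  by simp

definition energy_fun :: "real \<Rightarrow> real \<Rightarrow> real \<Rightarrow> real" where
  "energy_fun N\<^sub>0 W x = N\<^sub>0 * (2 powr (x / W) - 1)"

definition transmission_energy ::
  "nat \<Rightarrow> (nat \<Rightarrow> real) \<Rightarrow> real \<Rightarrow> real \<Rightarrow> real \<Rightarrow> (nat \<Rightarrow> real) \<Rightarrow> real" where
  "transmission_energy K s h N\<^sub>0 W l =
     (\<Sum>k=1..K. epoch_length s k / h\<^sup>2 * energy_fun N\<^sub>0 W (l k / epoch_length s k))"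

definition feasible_policies ::
  "nat \<Rightarrow> (nat \<Rightarrow> real) \<Rightarrow> (nat \<Rightarrow> real) \<Rightarrow> (nat \<Rightarrow> real) \<Rightarrow> real \<Rightarrow> real \<Rightarrow> real
     \<Rightarrow> (nat \<Rightarrow> real) set" where
  "feasible_policies K s a L f\<^sub>h C \<theta> =
     {l \<in> policies K.
        (\<Sum>k=1..K. computed_bits (capacity s a f\<^sub>h C) l k) = (\<Sum>k=1..K. l k) \<and>
        (\<Sum>k=1..K. l k) = (\<Sum>k=1..K-1. \<theta> * L k) \<and>
        (\<forall>k\<in>{1..K}. (\<Sum>j=1..k. l j) \<le> (\<Sum>j=1..k-1. \<theta> * L j))}"

definition energy_efficient_policy ::
  "nat \<Rightarrow> (nat \<Rightarrow> real) \<Rightarrow> (nat \<Rightarrow> real) \<Rightarrow> (nat \<Rightarrow> real) \<Rightarrow> real \<Rightarrow> real \<Rightarrow> real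
     \<Rightarrow> real \<Rightarrow> real \<Rightarrow> real \<Rightarrow> (nat \<Rightarrow> real) \<Rightarrow> bool" where
  "energy_efficient_policy K s a L f\<^sub>h C \<theta> h N\<^sub>0 W l \<longleftrightarrow>
     is_arg_min (transmission_energy K s h N\<^sub>0 W)
       (\<lambda>l. l \<in> feasible_policies K s a L f\<^sub>h C \<theta>) l"

definition unused_capacity ::
  "nat \<Rightarrow> (nat \<Rightarrow> real) \<Rightarrow> (nat \<Rightarrow> real) \<Rightarrow> (nat \<Rightarrow> real) \<Rightarrow> real \<Rightarrow> real \<Rightarrow> real \<Rightarrow> real" where
  "unused_capacity K s a L f\<^sub>h C \<theta> = cum_capacity s a f\<^sub>h C K - (\<Sum>k=1..K-1. \<theta> * L k)"

definition effective_tunnel ::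
  "nat \<Rightarrow> (nat \<Rightarrow> real) \<Rightarrow> (nat \<Rightarrow> real) \<Rightarrow> (nat \<Rightarrow> real) \<Rightarrow> real \<Rightarrow> real \<Rightarrow> real
     \<Rightarrow> (nat \<Rightarrow> real) set" where
  "effective_tunnel K s a L f\<^sub>h C \<theta> =
     {l. (\<forall>k\<in>{1..K-1}.
            max (cum_capacity s a f\<^sub>h C k - unused_capacity K s a L f\<^sub>h C \<theta>) 0 \<le> (\<Sum>j=1..k. l j) \<and>
            (\<Sum>j=1..k. l j) \<le> (\<Sum>j=1..k-1. \<theta> * L j)) \<and>
         (\<Sum>k=1..K. l k) = (\<Sum>k=1..K-1. \<theta> * L k)}"

text \<open>
  Length of the piecewise-linear curve through the points (s k, l 1 + ... + l k), for k = 0, ..., K.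
\<close>

definition path_length :: "nat \<Rightarrow> (nat \<Rightarrow> real) \<Rightarrow> (nat \<Rightarrow> real) \<Rightarrow> real" where
  "path_length K s l = (\<Sum>k=1..K. sqrt ((l k)\<^sup>2 + (epoch_length s k)\<^sup>2))"

definition shortest_path_in ::
  "nat \<Rightarrow> (nat \<Rightarrow> real) \<Rightarrow> (nat \<Rightarrow> real) set \<Rightarrow> (nat \<Rightarrow> real) \<Rightarrow> bool" where
  "shortest_path_in K s T l \<longleftrightarrow>
     is_arg_min (path_length K s) (\<lambda>l. l \<in> policies K \<inter> T) l"

end

theory Submission imports Defs "HOL-Analysis.Function_Topology"
begin

text \<open>
  Unrolling the buffer recursion, all bits are computed by the end iff no final segment of
  the epochs carries more bits than capacity; hence the feasible policies are exactly those in the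
  tunnel. A minimiser of the sum of l k ^ 2 / t k in the tunnel exists by compactness, and it is taut:
  its slope increases only where it touches the upper boundary and decreases only where it touches
  the lower one. By convexity and summation by parts, a taut policy is the unique minimiser of the
  sum of t k * f (l k / t k) for every strictly convex f. Energy and path length are both of this
  form.
\<close>

section \<open>Strict convexity through supporting lines\<close>

text \<open>Strict convexity of \<open>f\<close>, encoded by a supporting line of slope
  \<open>p x\<close> at each \<open>x\<close> that meets the graph nowhere else. No derivatives have
  to be taken.\<close>

definition strict_subgradient :: "(real \<Rightarrow> real) \<Rightarrow> (real \<Rightarrow> real) \<Rightarrow> bool" where
  "strict_subgradient f p \<longleftrightarrow> (\<forall>x y. x \<noteq> y \<longrightarrow> f x + p x * (y - x) < f y)"

text \<open>Add the supporting-line inequalities at two points, each evaluated at the other.\<close>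

lemma strict_subgradient_strict_mono:
  assumes "strict_subgradient f p"
  shows "strict_mono p"
proof (rule strict_monoI)
  fix x y :: real
  assume "x < y"
  then have "f x + p x * (y - x) < f y" "f y + p y * (x - y) < f x"
    using assms by (auto simp: strict_subgradient_def)
  then have "0 < (p y - p x) * (y - x)"
    by (simp add: algebra_simps)
  with \<open>x < y\<close> show "p x < p y"
    by (simp add: zero_less_mult_iff)
qed

text \<open>After division by \<open>c * exp (b * x)\<close> the claim becomes
  \<open>1 + z < exp z\<close> for the nonzero number \<open>z = b * (y - x)\<close>.\<close>

lemma strict_subgradient_exp:
  fixes c b :: real
  assumes "c > 0" "b \<noteq> 0"
  shows "strict_subgradient (\<lambda>x. c * (exp (b * x) - 1)) (\<lambda>x. c * b * exp (b * x))"
  unfolding strict_subgradient_def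
proof (intro allI impI)
  fix x y :: real
  assume "x \<noteq> y"
  define z where "z = b * (y - x)"
  have "z \<noteq> 0"
    using \<open>x \<noteq> y\<close> assms by (simp add: z_def)
  have "1 + z \<noteq> exp z"
  proof
    assume eq: "1 + z = exp z"
    then have "ln (1 + z) = (1 + z) - 1" by simp
    moreover have "1 + z > 0" unfolding eq by simp
    ultimately show False
      using ln_eq_minus_one[of "1 + z"] \<open>z \<noteq> 0\<close> by simp
  qed
  then have "1 + z < exp z"
    using exp_ge_add_one_self[of z] by linarith
  then have "c * exp (b * x) * (1 + z) < c * exp (b * x) * exp z"
    using \<open>c > 0\<close> by simp
  moreover have "exp (b * x) * exp z = exp (b * y)"
    by (simp add: z_def exp_add[symmetric] algebra_simps)
  ultimately show "c * (exp (b * x) - 1) + c * b * exp (b * x) * (y - x) < c * (exp (b * y) - 1)"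
    by (simp add: z_def algebra_simps)
qed

text \<open>This is strict Cauchy-Schwarz for the vectors (1, x) and (1, y); the gap between the two
  squared sides is \<open>(x - y)\<^sup>2\<close>.\<close>

lemma strict_subgradient_sqrt:
  "strict_subgradient (\<lambda>x. sqrt (1 + x\<^sup>2)) (\<lambda>x. x / sqrt (1 + x\<^sup>2))"
  unfolding strict_subgradient_def
proof (intro allI impI)
  fix x y :: real
  assume "x \<noteq> y"
  have pos: "0 < 1 + x\<^sup>2" by (simp add: add_pos_nonneg)
  have "0 < (x - y)\<^sup>2" using \<open>x \<noteq> y\<close> by simp
  then have "(1 + x * y)\<^sup>2 < (1 + x\<^sup>2) * (1 + y\<^sup>2)"
    by (simp add: power2_eq_square algebra_simps)
  then have "1 + x * y < sqrt ((1 + x\<^sup>2) * (1 + y\<^sup>2))"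
    by (rule real_less_rsqrt)
  then have "(1 + x * y) / sqrt (1 + x\<^sup>2) < sqrt (1 + y\<^sup>2)"
    using pos by (simp add: real_sqrt_mult divide_less_eq mult.commute)
  moreover have "sqrt (1 + x\<^sup>2) = (1 + x\<^sup>2) / sqrt (1 + x\<^sup>2)"
    using pos by (simp add: real_div_sqrt)
  then have "sqrt (1 + x\<^sup>2) + x / sqrt (1 + x\<^sup>2) * (y - x) = (1 + x * y) / sqrt (1 + x\<^sup>2)"
    by (simp add: add_divide_distrib diff_divide_distrib power2_eq_square algebra_simps)
  ultimately show "sqrt (1 + x\<^sup>2) + x / sqrt (1 + x\<^sup>2) * (y - x) < sqrt (1 + y\<^sup>2)"
    by simp
qed

section \<open>Optimality of taut policies\<close>

text \<open>Rewrites a first-order term in the increments \<open>d\<close> through partial sums, the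
  quantities that a tunnel constrains.\<close>

lemma sum_by_parts:
  fixes p d :: "nat \<Rightarrow> real"
  shows "(\<Sum>k=1..n. p k * d k) =
    p n * (\<Sum>j=1..n. d j) + (\<Sum>k=1..n-1. (p k - p (Suc k)) * (\<Sum>j=1..k. d j))"
proof (induction n)
  case (Suc n)
  then show ?case
    by (cases n) (simp_all add: algebra_simps)
qed simp

definition weighted_sum ::
  "nat \<Rightarrow> (nat \<Rightarrow> real) \<Rightarrow> (real \<Rightarrow> real) \<Rightarrow> (nat \<Rightarrow> real) \<Rightarrow> real" where
  "weighted_sum K t f l = (\<Sum>k=1..K. t k * f (l k / t k))"

definition tunnel_policies ::
  "nat \<Rightarrow> (nat \<Rightarrow> real) \<Rightarrow> (nat \<Rightarrow> real) \<Rightarrow> real \<Rightarrow> (nat \<Rightarrow> real) set" where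
  "tunnel_policies K lo hi A =
     {l \<in> policies K.
        (\<forall>k\<in>{1..K-1}. lo k \<le> (\<Sum>j=1..k. l j) \<and> (\<Sum>j=1..k. l j) \<le> hi k) \<and> (\<Sum>j=1..K. l j) = A}"

text \<open>The picture is a string pulled tight in the tunnel: it bends upwards only around the
  upper wall and downwards only around the lower one. No cost function occurs, so one policy can
  serve all of them.\<close>

definition taut ::
  "nat \<Rightarrow> (nat \<Rightarrow> real) \<Rightarrow> (nat \<Rightarrow> real) \<Rightarrow> (nat \<Rightarrow> real) \<Rightarrow> (nat \<Rightarrow> real) \<Rightarrow> bool" where
  "taut K t lo hi l \<longleftrightarrow>
     (\<forall>k\<in>{1..K-1}.
        (l k / t k < l (Suc k) / t (Suc k) \<longrightarrow> (\<Sum>j=1..k. l j) = hi k) \<and>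
        (l k / t k > l (Suc k) / t (Suc k) \<longrightarrow> (\<Sum>j=1..k. l j) = lo k))"

text \<open>Bound \<open>f\<close> from below by its supporting lines at the slopes of
  \<open>x\<close>. The resulting linear term, summed by parts, is nonnegative: where the slope of
  \<open>x\<close> rises, \<open>x\<close> is on the upper wall and \<open>y\<close> cannot be above
  it; where it falls, both signs flip.\<close>

lemma taut_less:
  assumes t: "\<And>k. k \<in> {1..K} \<Longrightarrow> t k > 0"
    and f: "strict_subgradient f p"
    and x: "x \<in> tunnel_policies K lo hi A" "taut K t lo hi x"
    and y: "y \<in> tunnel_policies K lo hi A" "y \<noteq> x"
  shows "weighted_sum K t f x < weighted_sum K t f y"
proof -
  define r where "r k = x k / t k" for k
  have tangent: "t k * f (x k / t k) + p (r k) * (y k - x k) \<le> t k * f (y k / t k)"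
    and strict: "x k \<noteq> y k \<Longrightarrow>
      t k * f (x k / t k) + p (r k) * (y k - x k) < t k * f (y k / t k)"
    if "k \<in> {1..K}" for k
  proof -
    show *: "t k * f (x k / t k) + p (r k) * (y k - x k) < t k * f (y k / t k)" if "x k \<noteq> y k"
    proof -
      have "x k / t k \<noteq> y k / t k"
        using t[OF \<open>k \<in> {1..K}\<close>] that by simp
      then have "f (x k / t k) + p (r k) * (y k / t k - x k / t k) < f (y k / t k)"
        using f unfolding strict_subgradient_def r_def by blast
      then have "t k * (f (x k / t k) + p (r k) * (y k / t k - x k / t k)) < t k * f (y k / t k)"
        using t[OF \<open>k \<in> {1..K}\<close>] by (rule mult_strict_left_mono)
      moreover have "t k * (f (x k / t k) + p (r k) * (y k / t k - x k / t k)) =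
          t k * f (x k / t k) + p (r k) * (y k - x k)"
        using t[OF \<open>k \<in> {1..K}\<close>] by (simp add: field_simps)
      ultimately show ?thesis by simp
    qed
    show "t k * f (x k / t k) + p (r k) * (y k - x k) \<le> t k * f (y k / t k)"
      using * by (cases "x k = y k") auto
  qed
  \<comment> \<open>Extensional functions agree outside the epochs, so distinct policies differ in
    some epoch \<open>m\<close>; one strict tangent estimate suffices.\<close>
  have "x \<in> extensional {1..K}" "y \<in> extensional {1..K}"
    using x y by (simp_all add: tunnel_policies_def policies_def PiE_def)
  then obtain m where m: "m \<in> {1..K}" "x m \<noteq> y m"
    using \<open>y \<noteq> x\<close> extensionalityI[of x "{1..K}" y] by blast
  have "(\<Sum>k=1..K. t k * f (x k / t k) + p (r k) * (y k - x k)) < weighted_sum K t f y"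
    unfolding weighted_sum_def
  proof (rule sum_strict_mono_ex1)
    show "\<exists>k\<in>{1..K}. t k * f (x k / t k) + p (r k) * (y k - x k) < t k * f (y k / t k)"
      using strict[OF m] m(1) by (rule bexI)
  qed (use tangent in simp_all)
  moreover have "0 \<le> (\<Sum>k=1..K. p (r k) * (y k - x k))"
  proof -
    have "0 \<le> (p (r k) - p (r (Suc k))) * (\<Sum>j=1..k. y j - x j)" if k: "k \<in> {1..K-1}" for k
    proof -
      have mono: "strict_mono p"
        using f by (rule strict_subgradient_strict_mono)
      have bounds: "lo k \<le> (\<Sum>j=1..k. y j)" "(\<Sum>j=1..k. y j) \<le> hi k"
        using y k by (auto simp: tunnel_policies_def)
      consider "r k < r (Suc k)" | "r k = r (Suc k)" | "r (Suc k) < r k" by linarith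
      then show ?thesis
      proof cases
        case 1
        then have "(\<Sum>j=1..k. x j) = hi k" "p (r k) < p (r (Suc k))"
          using x k mono by (auto simp: taut_def r_def strict_mono_less)
        then show ?thesis
          using bounds by (intro mult_nonpos_nonpos) (auto simp: sum_subtractf)
      next
        case 3
        then have "(\<Sum>j=1..k. x j) = lo k" "p (r (Suc k)) < p (r k)"
          using x k mono by (auto simp: taut_def r_def strict_mono_less)
        then show ?thesis
          using bounds by (intro mult_nonneg_nonneg) (auto simp: sum_subtractf)
      qed simp
    qed
    \<comment> \<open>Equal totals make the boundary term of the summation by parts vanish.\<close>
    moreover have "(\<Sum>j=1..K. y j - x j) = 0"
      using x y by (simp add: tunnel_policies_def sum_subtractf)
    ultimately show ?thesis
      by (subst sum_by_parts) (auto intro!: sum_nonneg)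
  qed
  ultimately show ?thesis
    by (simp add: sum.distrib weighted_sum_def)
qed

lemma taut_is_arg_min_iff:
  assumes t: "\<And>k. k \<in> {1..K} \<Longrightarrow> t k > 0"
    and f: "strict_subgradient f p"
    and x: "x \<in> tunnel_policies K lo hi A" "taut K t lo hi x"
  shows "is_arg_min (weighted_sum K t f) (\<lambda>l. l \<in> tunnel_policies K lo hi A) l \<longleftrightarrow> l = x"
  using taut_less[OF t f x] x(1) by (force simp: is_arg_min_def)

section \<open>Existence of a taut policy\<close>

text \<open>Nonnegative entries with total \<open>A\<close> lie in \<open>{0..A}\<close>, and
  outside the epochs the value is the single point \<open>undefined\<close>. So the set is a closed
  part of a product of compact sets, compact by Tychonoff.\<close>

lemma compact_tunnel_policies: "compact (tunnel_policies K lo hi A)"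
proof -
  define box :: "(nat \<Rightarrow> real) set"
    where "box = (\<Pi>\<^sub>E i\<in>UNIV. if i \<in> {1..K} then {0..A} else {undefined})"
  define S where "S k l = (\<Sum>j=1..k. l j)" for k and l :: "nat \<Rightarrow> real"
  have "compactin (product_topology (\<lambda>_::nat. euclidean) UNIV) box"
    unfolding box_def compactin_PiE by auto
  then have "compact box"
    by (simp add: euclidean_product_topology)
  have cont: "continuous_on UNIV (S k)" for k
    unfolding S_def by (intro continuous_on_sum continuous_on_product_coordinates)
  have "closed {l. (\<forall>k\<in>{1..K-1}. lo k \<le> S k l \<and> S k l \<le> hi k) \<and> S K l = A}"
    unfolding Ball_def
    by (intro closed_Collect_conj closed_Collect_all closed_Collect_imp open_Collect_const closed_Collect_le closed_Collect_eq
        continuous_on_const cont)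
  moreover have "tunnel_policies K lo hi A =
    box \<inter> {l. (\<forall>k\<in>{1..K-1}. lo k \<le> S k l \<and> S k l \<le> hi k) \<and> S K l = A}" (is "?T = ?B")
  proof
    show "?T \<subseteq> ?B"
    proof
      fix l assume l: "l \<in> ?T"
      have "l k \<le> A" if "k \<in> {1..K}" for k
        using member_le_sum[of k "{1..K}" l] that l
        by (auto simp: tunnel_policies_def policies_def PiE_def Pi_def)
      then show "l \<in> ?B"
        using l by (auto simp: tunnel_policies_def policies_def box_def S_def PiE_def Pi_def
            extensional_def)
    qed
    show "?B \<subseteq> ?T"
      by (auto simp: tunnel_policies_def policies_def box_def S_def PiE_iff extensional_def
          split: if_splits)
  qed
  ultimately show ?thesis
    using \<open>compact box\<close> by (simp add: compact_Int_closed)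
qed

text \<open>Moving \<open>e\<close> from epoch \<open>Suc k\<close> to epoch \<open>k\<close>
  cancels out in every partial sum that contains both epochs.\<close>

lemma sum_transfer:
  fixes x :: "nat \<Rightarrow> real"
  assumes "k \<ge> 1"
  shows "(\<Sum>j=1..n. (x(k := x k + e, Suc k := x (Suc k) - e)) j) =
    (\<Sum>j=1..n. x j) + (if n = k then e else 0)"
  using assms by (induction n) auto

text \<open>A minimiser of a quadratic cost is taut: at any violation, a small transfer between the
  two neighbouring epochs would stay in the tunnel and lower the cost.\<close>

lemma taut_exists:
  assumes t: "\<And>k. k \<in> {1..K} \<Longrightarrow> t k > 0"
    and "tunnel_policies K lo hi A \<noteq> {}"
  shows "\<exists>x\<in>tunnel_policies K lo hi A. taut K t lo hi x"
proof -
  let ?T = "tunnel_policies K lo hi A"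
  \<comment> \<open>For this cost the effect of a transfer is exactly a quadratic polynomial in
    \<open>e\<close>, so no limit argument is needed.\<close>
  define E where "E l = (\<Sum>k=1..K. (l k)\<^sup>2 / t k)" for l
  have "continuous_on ?T E"
    unfolding E_def using t
    by (intro continuous_intros continuous_on_subset[OF continuous_on_product_coordinates]) force+
  then obtain x where x: "x \<in> ?T" and min: "\<And>y. y \<in> ?T \<Longrightarrow> E x \<le> E y"
    using continuous_attains_inf[OF compact_tunnel_policies assms(2)] by blast
  have nonneg: "0 \<le> x k" if "k \<in> {1..K}" for k
    using x that by (auto simp: tunnel_policies_def policies_def)
  define r where "r k = x k / t k" for k
  have step: "0 \<le> e * (2 * (r k - r (Suc k)) + e * (1 / t k + 1 / t (Suc k)))"
    if k: "k \<in> {1..K-1}"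
      and e: "0 \<le> x k + e" "0 \<le> x (Suc k) - e"
        "lo k \<le> (\<Sum>j=1..k. x j) + e" "(\<Sum>j=1..k. x j) + e \<le> hi k"
    for k e
  proof -
    define y where "y = x(k := x k + e, Suc k := x (Suc k) - e)"
    have kK: "k \<in> {1..K}" "Suc k \<in> {1..K}" using k by auto
    have "y \<in> policies K"
      using x e kK by (auto simp: y_def tunnel_policies_def policies_def PiE_iff extensional_def)
    moreover have sums: "(\<Sum>j=1..n. y j) = (\<Sum>j=1..n. x j) + (if n = k then e else 0)" for n
      unfolding y_def using k by (intro sum_transfer) auto
    ultimately have "y \<in> ?T"
      using x e k by (auto simp: tunnel_policies_def sums)
    then have "E x \<le> E y" by (rule min)
    have split: "E l = (l k)\<^sup>2 / t k + (l (Suc k))\<^sup>2 / t (Suc k) +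
        (\<Sum>j\<in>{1..K} - {k} - {Suc k}. (l j)\<^sup>2 / t j)" for l
      unfolding E_def using kK
      by (subst sum.remove[of _ k], simp, simp, subst sum.remove[of _ "Suc k"]) auto
    have "(\<Sum>j\<in>{1..K} - {k} - {Suc k}. (y j)\<^sup>2 / t j) =
        (\<Sum>j\<in>{1..K} - {k} - {Suc k}. (x j)\<^sup>2 / t j)"
      by (intro sum.cong) (auto simp: y_def)
    then have "E y - E x = ((x k + e)\<^sup>2 - (x k)\<^sup>2) / t k +
        ((x (Suc k) - e)\<^sup>2 - (x (Suc k))\<^sup>2) / t (Suc k)"
      unfolding split by (simp add: y_def diff_divide_distrib)
    also have "\<dots> = e * (2 * (r k - r (Suc k)) + e * (1 / t k + 1 / t (Suc k)))"
      using t[OF kK(1)] t[OF kK(2)] by (simp add: r_def field_simps power2_eq_square)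
    finally show ?thesis using \<open>E x \<le> E y\<close> by simp
  qed
  have "taut K t lo hi x"
    unfolding taut_def
  proof (intro ballI conjI impI)
    fix k assume k: "k \<in> {1..K-1}"
    then have kK: "k \<in> {1..K}" "Suc k \<in> {1..K}" by auto
    define M where "M = 1 / t k + 1 / t (Suc k)"
    have M: "M > 0" unfolding M_def using t kK by (simp add: add_pos_pos)
    have S: "lo k \<le> (\<Sum>j=1..k. x j)" "(\<Sum>j=1..k. x j) \<le> hi k"
      using x k by (auto simp: tunnel_policies_def)
    {
      assume "x k / t k < x (Suc k) / t (Suc k)"
      then have less: "r k < r (Suc k)" by (simp add: r_def)
      show "(\<Sum>j=1..k. x j) = hi k"
      proof (rule ccontr)
        assume "(\<Sum>j=1..k. x j) \<noteq> hi k"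
        with S have gap: "0 < hi k - (\<Sum>j=1..k. x j)" by simp
        \<comment> \<open>The larger slope is positive, so epoch \<open>Suc k\<close> has bits to
          give away.\<close>
        have "0 < r (Suc k)"
          using less nonneg[OF kK(1)] t[OF kK(1)] by (auto simp: r_def intro: le_less_trans[rotated])
        then have x_pos: "0 < x (Suc k)"
          using t[OF kK(2)] by (simp add: r_def zero_less_divide_iff)
        \<comment> \<open>The first two bounds keep the transfer below the upper wall and
          nonnegative. The third gives \<open>e * M \<le> r (Suc k) - r k\<close>, so the linear
          part, with its factor 2, outweighs the quadratic one.\<close>
        define e where
          "e = min (min (hi k - (\<Sum>j=1..k. x j)) (x (Suc k))) ((r (Suc k) - r k) / M)"
        have e: "0 < e" "e \<le> hi k - (\<Sum>j=1..k. x j)" "e \<le> x (Suc k)" "e \<le> (r (Suc k) - r k) / M"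
          using gap x_pos less M by (auto simp: e_def)
        have "0 \<le> e * (2 * (r k - r (Suc k)) + e * M)"
          unfolding M_def using e S nonneg[OF kK(1)] by (intro step k) auto
        moreover have "e * M \<le> r (Suc k) - r k"
          using e(4) M by (simp add: pos_le_divide_eq)
        ultimately show False
          using e(1) less by (simp add: zero_le_mult_iff)
      qed
    next
      assume "x (Suc k) / t (Suc k) < x k / t k"
      then have less: "r (Suc k) < r k" by (simp add: r_def)
      show "(\<Sum>j=1..k. x j) = lo k"
      proof (rule ccontr)
        assume "(\<Sum>j=1..k. x j) \<noteq> lo k"
        with S have gap: "0 < (\<Sum>j=1..k. x j) - lo k" by simp
        have "0 < r k"
          using less nonneg[OF kK(2)] t[OF kK(2)] by (auto simp: r_def intro: le_less_trans[rotated])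
        then have x_pos: "0 < x k"
          using t[OF kK(1)] by (simp add: r_def zero_less_divide_iff)
        \<comment> \<open>The mirror image: bits move from epoch \<open>k\<close> to
          \<open>Suc k\<close>, so \<open>step\<close> is applied to \<open>- e\<close>.\<close>
        define e where
          "e = min (min ((\<Sum>j=1..k. x j) - lo k) (x k)) ((r k - r (Suc k)) / M)"
        have e: "0 < e" "e \<le> (\<Sum>j=1..k. x j) - lo k" "e \<le> x k" "e \<le> (r k - r (Suc k)) / M"
          using gap x_pos less M by (auto simp: e_def)
        have "0 \<le> (- e) * (2 * (r k - r (Suc k)) + (- e) * M)"
          unfolding M_def using e S nonneg[OF kK(2)] by (intro step k) auto
        moreover have "e * M \<le> r k - r (Suc k)"
          using e(4) M by (simp add: pos_le_divide_eq)
        ultimately show False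
          using e(1) less by (simp add: mult_le_0_iff)
      qed
    }
  qed
  with x show ?thesis by blast
qed

section \<open>Unrolling the buffer recursion\<close>

declare buffer_contents.simps [simp del]

lemma buffer_contents_Suc:
  "buffer_contents c l (Suc n) = max (buffer_contents c l n + l (Suc n) - c (Suc n)) 0"
  by (simp add: buffer_contents.simps[of c l "Suc n"])
    (simp add: buffer_contents.simps[of c l n] min_def max_def)

text \<open>The buffer is the maximum over \<open>k \<le> n\<close> of the net inflow in epochs
  \<open>k + 1\<close> to \<open>n\<close>. Stating this through upper bounds \<open>b\<close> lets
  the induction shift \<open>b\<close> by one epoch's net inflow; the new index \<open>Suc n\<close>
  contributes \<open>0 \<le> b\<close>.\<close>

lemma buffer_contents_le_iff:
  "buffer_contents c l n \<le> b \<longleftrightarrow>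
    (\<forall>k\<le>n. ((\<Sum>j=1..n. l j) - (\<Sum>j=1..k. l j)) - ((\<Sum>j=1..n. c j) - (\<Sum>j=1..k. c j)) \<le> b)"
proof (induction n arbitrary: b)
  case 0
  then show ?case by (simp add: buffer_contents_0)
next
  case (Suc n)
  have "buffer_contents c l (Suc n) \<le> b \<longleftrightarrow>
      buffer_contents c l n \<le> b - l (Suc n) + c (Suc n) \<and> 0 \<le> b"
    by (auto simp: buffer_contents_Suc)
  then show ?case
    unfolding Suc.IH by (simp add: le_Suc_eq all_conj_distrib algebra_simps)
qed

text \<open>The index \<open>k = n\<close> has net inflow zero.\<close>

lemma buffer_contents_nonneg: "0 \<le> buffer_contents c l n"
  using buffer_contents_le_iff[of c l n "buffer_contents c l n"] by auto

text \<open>All bits are computed iff the final buffer is empty, that is, iff the inflow after each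
  epoch \<open>k\<close> fits the remaining capacity. Subtracting from the totals turns this into
  the lower wall of the tunnel.\<close>

lemma feasible_policies_eq_effective_tunnel:
  assumes "K \<ge> 1"
    and "(\<Sum>k=1..K-1. \<theta> * L k) \<le> cum_capacity s a f\<^sub>h C K"
  shows "feasible_policies K s a L f\<^sub>h C \<theta> = policies K \<inter> effective_tunnel K s a L f\<^sub>h C \<theta>"
proof (rule set_eqI)
  fix l
  let ?c = "capacity s a f\<^sub>h C"
  let ?U = "cum_capacity s a f\<^sub>h C"
  let ?A = "\<Sum>k=1..K-1. \<theta> * L k"
  have computed: "(\<Sum>k=1..K. computed_bits ?c l k) = (\<Sum>k=1..K. l k) \<longleftrightarrow>
      (\<forall>k\<in>{1..K-1}. ?U k - unused_capacity K s a L f\<^sub>h C \<theta> \<le> (\<Sum>j=1..k. l j))"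
    if "(\<Sum>j=1..K. l j) = ?A"
  proof -
    have "(\<Sum>k=1..K. computed_bits ?c l k) = (\<Sum>k=1..K. l k) \<longleftrightarrow> buffer_contents ?c l K \<le> 0"
      using buffer_contents_nonneg[of ?c l K] by (auto simp: buffer_contents.simps)
    also have "\<dots> \<longleftrightarrow> (\<forall>k\<le>K. ?U k - unused_capacity K s a L f\<^sub>h C \<theta> \<le> (\<Sum>j=1..k. l j))"
      unfolding buffer_contents_le_iff that
      by (simp add: unused_capacity_def cum_capacity_def algebra_simps)
    also have "\<dots> \<longleftrightarrow>
        (\<forall>k\<in>{1..K-1}. ?U k - unused_capacity K s a L f\<^sub>h C \<theta> \<le> (\<Sum>j=1..k. l j))"
    proof -
      have "{..K} = insert 0 (insert K {1..K-1})" using assms(1) by auto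
      moreover have "?U 0 - unused_capacity K s a L f\<^sub>h C \<theta> \<le> (\<Sum>j=1..0. l j)"
        using assms(2) by (simp add: unused_capacity_def cum_capacity_def)
      moreover have "?U K - unused_capacity K s a L f\<^sub>h C \<theta> \<le> (\<Sum>j=1..K. l j)"
        using that by (simp add: unused_capacity_def)
      ultimately show ?thesis
        unfolding atMost_iff[symmetric] Ball_def[symmetric] by simp
    qed
    finally show ?thesis .
  qed
  have split: "(\<forall>k\<in>{1..K}. P k) \<longleftrightarrow> (\<forall>k\<in>{1..K-1}. P k) \<and> P K" for P
  proof -
    have "{1..K} = insert K {1..K-1}" using assms(1) by auto
    then show ?thesis by auto
  qed
  \<comment> \<open>Nonnegativity of policies accounts for the maximum with 0 in the lower
    wall.\<close>
  have "0 \<le> (\<Sum>j=1..k. l j)" if "l \<in> policies K" "k \<in> {1..K-1}" for k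
    using that by (intro sum_nonneg) (auto simp: policies_def PiE_iff)
  then show "l \<in> feasible_policies K s a L f\<^sub>h C \<theta> \<longleftrightarrow>
      l \<in> policies K \<inter> effective_tunnel K s a L f\<^sub>h C \<theta>"
    unfolding feasible_policies_def effective_tunnel_def split using computed by auto
qed


section \<open>Energy and path length as instances\<close>

theorem lemma4:
  fixes K :: nat
    and s a L :: "nat \<Rightarrow> real"
    and f\<^sub>h C Q \<theta> h N\<^sub>0 W :: real
  assumes "K \<ge> 1"
    and "s 0 = 0" and "\<And>k. k < K \<Longrightarrow> s k < s (Suc k)"
    and "\<And>k. k \<in> {1..K} \<Longrightarrow> a k \<in> {0, 1}" and "a K = 1"
    and "\<And>k. k \<in> {1..K} \<Longrightarrow> L k \<ge> 0"
    and "f\<^sub>h > 0" and "C > 0" and "h > 0" and "N\<^sub>0 > 0" and "W > 0"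
    and "\<theta> \<in> {0..1}"
    and large_buffer: "Q \<ge> (\<Sum>k=1..K. L k)"
    and underutilized: "(\<Sum>k=1..K-1. \<theta> * L k) < cum_capacity s a f\<^sub>h C K"
    and feasible: "feasible_policies K s a L f\<^sub>h C \<theta> \<noteq> {}"
  shows "(\<exists>!l. energy_efficient_policy K s a L f\<^sub>h C \<theta> h N\<^sub>0 W l) \<and>
         (\<forall>l. energy_efficient_policy K s a L f\<^sub>h C \<theta> h N\<^sub>0 W l \<longleftrightarrow>
              shortest_path_in K s (effective_tunnel K s a L f\<^sub>h C \<theta>) l)"
proof -
  define t where "t = epoch_length s"
  define lo where "lo k = max (cum_capacity s a f\<^sub>h C k - unused_capacity K s a L f\<^sub>h C \<theta>) 0" for k
  define hi where "hi k = (\<Sum>j=1..k-1. \<theta> * L j)" for k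
  define T where "T = tunnel_policies K lo hi (\<Sum>k=1..K-1. \<theta> * L k)"
  have tunnel: "policies K \<inter> effective_tunnel K s a L f\<^sub>h C \<theta> = T"
    by (auto simp: T_def tunnel_policies_def effective_tunnel_def lo_def hi_def)
  have feas: "feasible_policies K s a L f\<^sub>h C \<theta> = T"
    using feasible_policies_eq_effective_tunnel[of K \<theta> L s a f\<^sub>h C] underutilized \<open>K \<ge> 1\<close> tunnel
    by simp
  have t: "t k > 0" if "k \<in> {1..K}" for k
    using assms(3)[of "k - 1"] that by (auto simp: t_def epoch_length_def)
  \<comment> \<open>The factor \<open>1 / h\<^sup>2\<close> is absorbed and base 2 is rewritten as
    \<open>exp\<close> with rate \<open>ln 2 / W\<close>.\<close>
  define g where "g x = N\<^sub>0 / h\<^sup>2 * (exp (ln 2 / W * x) - 1)" for x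
  have energy: "transmission_energy K s h N\<^sub>0 W = weighted_sum K t g"
    by (simp add: fun_eq_iff transmission_energy_def weighted_sum_def g_def t_def energy_fun_def
        powr_def mult.commute)
  \<comment> \<open>Factoring \<open>t k\<close> out of each segment length leaves a function of the
    slope alone.\<close>
  have len: "path_length K s = weighted_sum K t (\<lambda>x. sqrt (1 + x\<^sup>2))"
  proof
    fix l
    have "sqrt ((l k)\<^sup>2 + (t k)\<^sup>2) = t k * sqrt (1 + (l k / t k)\<^sup>2)" if "k \<in> {1..K}" for k
    proof -
      have "(l k)\<^sup>2 + (t k)\<^sup>2 = (t k)\<^sup>2 * (1 + (l k / t k)\<^sup>2)"
        using t[OF that] by (simp add: field_simps power2_eq_square)
      then show ?thesis using t[OF that] by (simp add: real_sqrt_mult)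
    qed
    then show "path_length K s l = weighted_sum K t (\<lambda>x. sqrt (1 + x\<^sup>2)) l"
      by (simp add: path_length_def weighted_sum_def t_def)
  qed
  \<comment> \<open>The same taut \<open>x\<close> is the unique minimiser for both costs.\<close>
  obtain x where x: "x \<in> T" "taut K t lo hi x"
    using taut_exists[where t = t, OF t] feasible feas
    unfolding T_def by blast
  have sub: "strict_subgradient g (\<lambda>x. N\<^sub>0 / h\<^sup>2 * (ln 2 / W) * exp (ln 2 / W * x))"
    unfolding g_def using \<open>h > 0\<close> \<open>N\<^sub>0 > 0\<close> \<open>W > 0\<close> by (intro strict_subgradient_exp) auto
  have "energy_efficient_policy K s a L f\<^sub>h C \<theta> h N\<^sub>0 W l \<longleftrightarrow> l = x" for l
    unfolding energy_efficient_policy_def feas energy T_def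
    using t sub x by (intro taut_is_arg_min_iff) (auto simp: T_def)
  moreover have "shortest_path_in K s (effective_tunnel K s a L f\<^sub>h C \<theta>) l \<longleftrightarrow> l = x" for l
    unfolding shortest_path_in_def tunnel len T_def
    using t strict_subgradient_sqrt x by (intro taut_is_arg_min_iff) (auto simp: T_def)
  ultimately show ?thesis by simp
qed

end
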